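(* Let $p$ be a prime and let $K$ be a finite extension of $\mathbb{Q}_p$ with valuation ring $\mathcal{O}_K$, residue field of cardinality $q$, uniformising parameter $\pi$ and absolute ramification index $e_K$. Let $P\in\mathcal{O}_K[[X]]$ be a Lubin-Tate series with respect to $\pi$, and let $F_P$ be the associated Lubin-Tate formal group with formal group exponential $\exp_{F_P}(X)\in XK[[X]]$. Then the power series $\exp_{F_P}(X)$ converges on the disc $$\Big\{x\in\mathbb{C}_p: v_p(x)>\frac{1}{e_K(q-1)}\Big\}.$$
   Context: $\mathbb{C}_p$ is the completion of an algebraic closure of $\mathbb{Q}_p$ and $v_p$ its valuation with $v_p(p)=1$. $e_K=v_\pi(p)$, where $v_\pi$ is the discrete valuation on $K$ with $v_\pi(\pi)=1$. $P\in\mathcal{O}_K[[X]]$ is a Lubin-Tate series with respect to $\pi$ if $P(X)\equiv \pi X \bmod X^2\mathcal{O}_K[[X]]$ and $P(X)\equiv X^q\bmod \pi\mathcal{O}_K[[X]]$. $F_P(X,Y)\in\mathcal{O}_K[[X,Y]]$ is the unique one-dimensional commutative formal group with $P(F_P(X,Y))=F_P(P(X),P(Y))$, and $\exp_{F_P}\in XK[[X]]$ is the unique power series with $\exp_{F_P}(X)\equiv X\bmod X^2K[[X]]$ and $\exp_{F_P}(X+Y)=F_P(\exp_{F_P}(X),\exp_{F_P}(Y))$. *)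

theory Defs
  imports
    "HOL-Analysis.Elementary_Metric_Spaces"
    "HOL-Computational_Algebra.Polynomial"
    "HOL-Computational_Algebra.Formal_Power_Series"
    "HOL-Computational_Algebra.Primes"
    "HOL-Library.Extended_Real"
begin

section \<open>The field of p-adic complex numbers\<close>

definition algebraic_over :: "'a::field set \<Rightarrow> 'a set" where
  "algebraic_over S = {x. \<exists>f. f \<noteq> 0 \<and> (\<forall>i. poly.coeff f i \<in> S) \<and> poly f x = 0}"

text \<open>In a complete field carrying the \<open>p\<close>-adic metric, the closure of the prime field
  is the completion of the rationals, i.e. \<open>\<rat>\<^sub>p\<close>.\<close>

definition padic_rationals :: "'a::{field_char_0, complete_space} set" where
  "padic_rationals = closure (range of_rat)"

text \<open>The type \<open>'a\<close> with the valuation \<open>v\<close> is a completion of an algebraic closure of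
  \<open>\<rat>\<^sub>p\<close>, normalised by \<open>v p = 1\<close>. Completeness is part of the class \<open>complete_space\<close>, whose
  metric is required to be the one given by the absolute value \<open>p powr (- v x)\<close>.
  These axioms determine \<open>('a, v)\<close> up to isometric isomorphism.\<close>

locale padic_complex =
  fixes p :: nat and v :: "'a::{field_char_0, complete_space} \<Rightarrow> ereal"
  assumes prime_p: "prime p"
    and v_eq_infty_iff: "v x = \<infinity> \<longleftrightarrow> x = 0"
    and v_not_minfty: "v x \<noteq> -\<infinity>"
    and v_mult: "v (x * y) = v x + v y"
    and v_add: "v (x + y) \<ge> min (v x) (v y)"
    and v_p: "v (of_nat p) = 1"
    and dist_v: "dist x y = (if x = y then 0 else real p powr (- real_of_ereal (v (x - y))))"
    and algebraic_closure_closed: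
      "\<And>f :: 'a poly. (\<forall>i. poly.coeff f i \<in> algebraic_over padic_rationals) \<Longrightarrow> degree f > 0 \<Longrightarrow>
         \<exists>z \<in> algebraic_over padic_rationals. poly f z = 0"
    and algebraic_closure_dense: "closure (algebraic_over (padic_rationals :: 'a set)) = UNIV"


section \<open>Finite extensions of the p-adic numbers\<close>

definition is_subfield :: "'a::field set \<Rightarrow> bool" where
  "is_subfield K \<longleftrightarrow> 0 \<in> K \<and> 1 \<in> K \<and>
     (\<forall>x\<in>K. \<forall>y\<in>K. x + y \<in> K \<and> x * y \<in> K) \<and> (\<forall>x\<in>K. - x \<in> K \<and> inverse x \<in> K)"

text \<open>Finite extensions are taken inside the fixed completed algebraic closure.\<close>

definition finite_extension_Qp :: "'a::{field_char_0, complete_space} set \<Rightarrow> bool" where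
  "finite_extension_Qp K \<longleftrightarrow> is_subfield K \<and> padic_rationals \<subseteq> K \<and>
     (\<exists>B. finite B \<and> B \<subseteq> K \<and>
       (\<forall>x\<in>K. \<exists>c. (\<forall>b\<in>B. c b \<in> padic_rationals) \<and> x = (\<Sum>b\<in>B. c b * b)))"

definition val_ring :: "('a::field \<Rightarrow> ereal) \<Rightarrow> 'a set \<Rightarrow> 'a set" where
  "val_ring v K = {x \<in> K. v x \<ge> 0}"

definition max_ideal :: "('a::field \<Rightarrow> ereal) \<Rightarrow> 'a set \<Rightarrow> 'a set" where
  "max_ideal v K = {x \<in> K. v x > 0}"

definition residue_card :: "('a::field \<Rightarrow> ereal) \<Rightarrow> 'a set \<Rightarrow> nat" where
  "residue_card v K =
     card (val_ring v K // {(x, y). x \<in> val_ring v K \<and> y \<in> val_ring v K \<and> x - y \<in> max_ideal v K})"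

definition uniformiser :: "('a::field \<Rightarrow> ereal) \<Rightarrow> 'a set \<Rightarrow> 'a \<Rightarrow> bool" where
  "uniformiser v K \<pi> \<longleftrightarrow> \<pi> \<in> val_ring v K \<and> max_ideal v K = (\<lambda>y. \<pi> * y) ` val_ring v K"

text \<open>The discrete valuation of \<open>K\<close> with value 1 at \<open>\<pi>\<close>; only meaningful at nonzero
  elements of \<open>K\<close>.\<close>

definition val_pi :: "('a::field \<Rightarrow> ereal) \<Rightarrow> 'a set \<Rightarrow> 'a \<Rightarrow> 'a \<Rightarrow> int" where
  "val_pi v K \<pi> x =
     (THE n. \<exists>u \<in> val_ring v K. inverse u \<in> val_ring v K \<and> u \<noteq> 0 \<and> x = \<pi> powi n * u)"

definition ramification_index :: "nat \<Rightarrow> ('a::field \<Rightarrow> ereal) \<Rightarrow> 'a set \<Rightarrow> 'a \<Rightarrow> int" where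
  "ramification_index p v K \<pi> = val_pi v K \<pi> (of_nat p)"


section \<open>Power series in several variables and substitution\<close>

definition fps_over :: "'a set \<Rightarrow> 'a fps set" where
  "fps_over S = {f. \<forall>n. fps_nth f n \<in> S}"

text \<open>\<open>'a fps fps\<close> is read as \<open>'a[[X]][[Y]]\<close> and \<open>'a fps fps fps\<close> as \<open>'a[[X]][[Y]][[Z]]\<close>:
  the outermost series variable is the last one.\<close>

definition coeff2 :: "'a fps fps \<Rightarrow> nat \<Rightarrow> nat \<Rightarrow> 'a" where
  "coeff2 F i j = fps_nth (fps_nth F j) i"

definition coeff3 :: "'a fps fps fps \<Rightarrow> nat \<Rightarrow> nat \<Rightarrow> nat \<Rightarrow> 'a" where
  "coeff3 F i j k = fps_nth (fps_nth (fps_nth F k) j) i"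

definition X2 :: "'a::comm_ring_1 fps fps" where "X2 = fps_const fps_X"
definition Y2 :: "'a::comm_ring_1 fps fps" where "Y2 = fps_X"

definition X3 :: "'a::comm_ring_1 fps fps fps" where "X3 = fps_const (fps_const fps_X)"
definition Y3 :: "'a::comm_ring_1 fps fps fps" where "Y3 = fps_const fps_X"
definition Z3 :: "'a::comm_ring_1 fps fps fps" where "Z3 = fps_X"

text \<open>Substitution of series without constant term. Products of \<open>n\<close> such series have no
  terms of total degree below \<open>n\<close>, so each coefficient of the result is the finite sum below.
  The library's \<open>fps_compose\<close> does not apply: it needs the constant term with respect to the
  outermost variable alone to vanish.\<close>

definition subst1_2 :: "'a::comm_ring_1 fps \<Rightarrow> 'a fps fps \<Rightarrow> 'a fps fps" where
  "subst1_2 f G = Abs_fps (\<lambda>j. Abs_fps (\<lambda>i. \<Sum>n\<le>i+j. fps_nth f n * coeff2 (G ^ n) i j))"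

definition subst2_2 :: "'a::comm_ring_1 fps fps \<Rightarrow> 'a fps fps \<Rightarrow> 'a fps fps \<Rightarrow> 'a fps fps" where
  "subst2_2 F G H = Abs_fps (\<lambda>j. Abs_fps (\<lambda>i.
     \<Sum>a\<le>i+j. \<Sum>b\<le>i+j. coeff2 F a b * coeff2 (G ^ a * H ^ b) i j))"

definition subst2_3 ::
    "'a::comm_ring_1 fps fps \<Rightarrow> 'a fps fps fps \<Rightarrow> 'a fps fps fps \<Rightarrow> 'a fps fps fps" where
  "subst2_3 F G H = Abs_fps (\<lambda>k. Abs_fps (\<lambda>j. Abs_fps (\<lambda>i.
     \<Sum>a\<le>i+j+k. \<Sum>b\<le>i+j+k. coeff2 F a b * coeff3 (G ^ a * H ^ b) i j k)))"


section \<open>Lubin-Tate formal groups\<close>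

definition lubin_tate_series :: "('a::field \<Rightarrow> ereal) \<Rightarrow> 'a set \<Rightarrow> 'a \<Rightarrow> 'a fps \<Rightarrow> bool" where
  "lubin_tate_series v K \<pi> P \<longleftrightarrow> P \<in> fps_over (val_ring v K) \<and>
     (\<exists>Q \<in> fps_over (val_ring v K). P - fps_const \<pi> * fps_X = fps_X ^ 2 * Q) \<and>
     (\<exists>Q \<in> fps_over (val_ring v K). P - fps_X ^ residue_card v K = fps_const \<pi> * Q)"

text \<open>One-dimensional commutative formal groups over a subring \<open>R\<close>. The identities
  \<open>F(X,0) = X\<close>, \<open>F(0,Y) = Y\<close> and the existence of an inverse series follow.\<close>

definition comm_formal_group :: "'a::comm_ring_1 set \<Rightarrow> 'a fps fps \<Rightarrow> bool" where
  "comm_formal_group R F \<longleftrightarrow> F \<in> fps_over (fps_over R) \<and>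
     coeff2 F 0 0 = 0 \<and> coeff2 F 1 0 = 1 \<and> coeff2 F 0 1 = 1 \<and>
     subst2_3 F (subst2_3 F X3 Y3) Z3 = subst2_3 F X3 (subst2_3 F Y3 Z3) \<and>
     subst2_2 F Y2 X2 = F"

definition lubin_tate_formal_group ::
    "('a::field \<Rightarrow> ereal) \<Rightarrow> 'a set \<Rightarrow> 'a fps \<Rightarrow> 'a fps fps \<Rightarrow> bool" where
  "lubin_tate_formal_group v K P F \<longleftrightarrow> comm_formal_group (val_ring v K) F \<and>
     subst1_2 P F = subst2_2 F (subst1_2 P X2) (subst1_2 P Y2)"

definition formal_group_exp :: "'a::field set \<Rightarrow> 'a fps fps \<Rightarrow> 'a fps \<Rightarrow> bool" where
  "formal_group_exp K F E \<longleftrightarrow> E \<in> fps_over K \<and> fps_nth E 0 = 0 \<and>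
     (\<exists>Q \<in> fps_over K. E - fps_X = fps_X ^ 2 * Q) \<and>
     subst1_2 E (X2 + Y2) = subst2_2 F (subst1_2 E X2) (subst1_2 E Y2)"

end

theory Submission
  imports Defs
begin

unbundle fps_syntax

section \<open>Coefficients of substitutions in the last variable\<close>

text \<open>The exponential conjugates \<open>P\<close> to multiplication by \<open>\<pi>\<close>:
  P(E(X)) = E(\<pi> X) (\<open>compose_exp_eq_exp_scaled\<close>). Comparing coefficients of X^n for
  n at least 2 gives (\<pi>^n - \<pi>) E_n = sum of P_k (E^k)_n over k from 2 to n, a recursion for
  E_n in terms of lower coefficients. Let t = p^(-1/(e(q-1))) be the radius of the disc. Since
  |\<pi>| = p^(-1/e) (\<open>absv_uniformiser_eq\<close>), t^(q-1) = |\<pi>|. Induction then yields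
  |E_n| t^n \<le> t (\<open>absv_exp_nth_le\<close>): the factor on the left has size at least
  |\<pi>|, while each term on the right gains |\<pi>|, from P_k if k differs from q and from t^(q-1)
  if k = q. So for |x| < t the terms E_n x^n decay geometrically, and completeness gives convergence
  (\<open>summable_of_geometric_bound\<close>).\<close>

text \<open>The powers \<open>g ^ n\<close> with \<open>n > i\<close> vanish up to degree
  \<open>i\<close>, so every cutoff \<open>m \<ge> i\<close> gives the same sum. This freedom
  absorbs the cutoffs by total degree in the substitutions.\<close>

lemma fps_compose_mult_nth:
  fixes f g h :: "'a::comm_ring_1 fps"
  assumes "g $ 0 = 0" and "i \<le> m"
  shows "((f oo g) * h) $ i = (\<Sum>n\<le>m. f $ n * (g ^ n * h) $ i)"
proof -
  have nth: "(f oo g) $ j = (\<Sum>n\<le>m. f $ n * (g ^ n) $ j)" if "j \<le> i" for j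
  proof -
    have "(f oo g) $ j = (\<Sum>n\<in>{0..j}. f $ n * (g ^ n) $ j)"
      by (simp add: fps_compose_nth)
    also have "\<dots> = (\<Sum>n\<le>m. f $ n * (g ^ n) $ j)"
      using that assms startsby_zero_power_prefix[OF assms(1)]
      by (intro sum.mono_neutral_left) auto
    finally show ?thesis .
  qed
  have "((f oo g) * h) $ i = (\<Sum>j=0..i. \<Sum>n\<le>m. f $ n * ((g ^ n) $ j * h $ (i - j)))"
    by (simp add: fps_mult_nth nth sum_distrib_right mult.assoc)
  also have "\<dots> = (\<Sum>n\<le>m. f $ n * (g ^ n * h) $ i)"
    by (subst sum.swap) (simp add: fps_mult_nth sum_distrib_left)
  finally show ?thesis .
qed

lemma subst1_2_nth_0: "subst1_2 f G $ 0 = f oo (G $ 0)"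
  by (rule fps_ext)
    (simp add: subst1_2_def coeff2_def fps_compose_nth fps_power_zeroth atLeast0AtMost)

text \<open>Chain rule: \<open>G $ 0\<close> is G(X,0) and \<open>G $ 1\<close> is the Y-derivative
  of G at Y = 0.\<close>

lemma subst1_2_nth_1:
  assumes "G $ 0 $ 0 = 0"
  shows "subst1_2 f G $ 1 = (fps_deriv f oo G $ 0) * G $ 1"
proof (rule fps_ext)
  fix i
  have "subst1_2 f G $ 1 $ i
      = (\<Sum>n\<le>Suc i. f $ n * (of_nat n * (G $ 0) ^ (n - 1) * G $ 1) $ i)"
    by (simp add: subst1_2_def coeff2_def fps_power_first[unfolded One_nat_def] del: sum.atMost_Suc)
  also have "\<dots> = (\<Sum>n\<le>i. f $ Suc n * (of_nat (Suc n) * ((G $ 0) ^ n * G $ 1)) $ i)"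
    by (subst sum.atMost_Suc_shift) (simp add: mult.assoc del: of_nat_Suc)
  also have "\<dots> = (\<Sum>n\<le>i. fps_deriv f $ n * ((G $ 0) ^ n * G $ 1) $ i)"
    by (intro sum.cong refl)
      (simp only: fps_of_nat[symmetric] fps_mult_left_const_nth fps_deriv_nth, simp add: mult_ac)
  also have "\<dots> = ((fps_deriv f oo G $ 0) * G $ 1) $ i"
    using fps_compose_mult_nth[of "G $ 0" i i] assms by simp
  finally show "subst1_2 f G $ 1 $ i = ((fps_deriv f oo G $ 0) * G $ 1) $ i" .
qed

lemma subst2_2_nth_0:
  assumes "H $ 0 = 0"
  shows "subst2_2 F (fps_const g) H $ 0 = F $ 0 oo g"
proof (rule fps_ext)
  fix i
  have "coeff2 (fps_const g ^ a * H ^ b) i 0 = (if b = 0 then (g ^ a) $ i else 0)" for a b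
    by (cases b) (simp_all add: coeff2_def fps_power_zeroth assms)
  then have "subst2_2 F (fps_const g) H $ 0 $ i
      = (\<Sum>a\<le>i. \<Sum>b\<le>i. coeff2 F a b * (if b = 0 then (g ^ a) $ i else 0))"
    by (simp only: subst2_2_def fps_nth_Abs_fps add_0_right)
  also have "\<dots> = (\<Sum>a\<le>i. F $ 0 $ a * (g ^ a) $ i)"
    by (simp add: mult_delta_right coeff2_def)
  also have "\<dots> = (F $ 0 oo g) $ i"
    by (simp add: fps_compose_nth atLeast0AtMost)
  finally show "subst2_2 F (fps_const g) H $ 0 $ i = (F $ 0 oo g) $ i" .
qed

text \<open>Chain rule again: the first argument does not involve Y, so only the partial derivative
  of F in its second variable, at (g,0), survives.\<close>

lemma subst2_2_nth_1:
  assumes "H $ 0 = 0" and "g $ 0 = 0"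
  shows "subst2_2 F (fps_const g) H $ 1 = (F $ 1 oo g) * H $ 1"
proof (rule fps_ext)
  fix i
  have "(H ^ b) $ 1 = (if b = 1 then H $ 1 else 0)" for b
  proof -
    consider "b = 0" | "b = 1" | "b - 1 > 0" by linarith
    then show ?thesis
      by cases (auto simp: fps_power_first assms(1) zero_power simp del: One_nat_def)
  qed
  then have "coeff2 (fps_const g ^ a * H ^ b) i 1
      = (if b = 1 then (g ^ a * H $ 1) $ i else 0)" for a b
    by (simp add: coeff2_def)
  then have "subst2_2 F (fps_const g) H $ 1 $ i
      = (\<Sum>a\<le>i + 1. \<Sum>b\<le>i + 1. coeff2 F a b * (if b = 1 then (g ^ a * H $ 1) $ i else 0))"
    by (simp only: subst2_2_def fps_nth_Abs_fps)
  also have "\<dots> = (\<Sum>a\<le>Suc i. F $ 1 $ a * (g ^ a * H $ 1) $ i)"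
    by (simp add: mult_delta_right coeff2_def del: sum.atMost_Suc)
  also have "\<dots> = ((F $ 1 oo g) * H $ 1) $ i"
    using fps_compose_mult_nth[of g i "Suc i"] assms by simp
  finally show "subst2_2 F (fps_const g) H $ 1 $ i = ((F $ 1 oo g) * H $ 1) $ i" .
qed

lemma subst1_2_X2: "subst1_2 f X2 = fps_const f"
proof (intro fps_ext)
  fix j i
  have "coeff2 (X2 ^ n) i j = (if n = i then if j = 0 then 1 else 0 else (0::'a))" for n
    by (simp add: X2_def coeff2_def)
  then show "subst1_2 f X2 $ j $ i = fps_const f $ j $ i"
    by (simp add: subst1_2_def mult_delta_right)
qed

lemma subst1_2_Y2_nth: "subst1_2 f Y2 $ j = fps_const (f $ j)"
proof (rule fps_ext)
  fix i
  have "coeff2 (Y2 ^ n) i j = (if n = j then if i = 0 then 1 else 0 else (0::'a))" for n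
    by (simp add: Y2_def coeff2_def)
  then show "subst1_2 f Y2 $ j $ i = fps_const (f $ j) $ i"
    by (simp add: subst1_2_def mult_delta_right)
qed

section \<open>The exponential linearises the Lubin-Tate series\<close>

text \<open>With \<open>\<omega>(X) = \<partial>F/\<partial>Y(X,0)\<close>, the derivatives of the two functional equations in the
  second variable read \<open>E' = \<omega>(E)\<close> and \<open>P' \<omega> = P'(0) \<omega>(P)\<close>. Hence the logarithm \<open>L\<close>,
  the inverse of \<open>E\<close>, has \<open>L' = 1/\<omega>\<close> and \<open>L(P) = P'(0) L\<close>.\<close>

lemma compose_exp_eq_exp_scaled:
  fixes E P :: "'a::field_char_0 fps"
  assumes E0: "E $ 0 = 0" and E1: "E $ 1 = 1" and P0: "P $ 0 = 0"
    and E: "subst1_2 E (X2 + Y2) = subst2_2 F (subst1_2 E X2) (subst1_2 E Y2)"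
    and P: "subst1_2 P F = subst2_2 F (subst1_2 P X2) (subst1_2 P Y2)"
  shows "P oo E = E oo (fps_const (P $ 1) * fps_X)"
proof -
  define \<omega> where "\<omega> = F $ 1"
  define L where "L = fps_inv E"
  have L0: "L $ 0 = 0"
    by (simp add: L_def fps_inv_def)
  have EL: "E oo L = fps_X" and LE: "L oo E = fps_X"
    unfolding L_def using E0 E1 by (auto intro: fps_inv fps_inv_right)
  have Y0: "subst1_2 f Y2 $ 0 = 0" if "f $ 0 = 0" for f :: "'a fps"
    using that by (simp add: subst1_2_Y2_nth)
  have XY: "((X2 + Y2) :: 'a fps fps) $ 0 = fps_X" "((X2 + Y2) :: 'a fps fps) $ 1 = 1"
    and X0: "(fps_X :: 'a fps) $ 0 = 0"
    by (simp_all add: X2_def Y2_def)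
  \<comment> \<open>Setting Y = 0 in the addition formula gives E(X) = F(E(X),0); composing with
    \<open>L\<close> turns this into F(X,0) = X.\<close>
  have "E = F $ 0 oo E"
    using arg_cong[OF E, of "\<lambda>G. G $ 0"]
    by (simp only: subst1_2_nth_0 XY subst1_2_X2 subst2_2_nth_0[OF Y0[OF E0]] fps_compose_fps_X)
  then have "E oo L = (F $ 0 oo E) oo L"
    by simp
  then have F0: "F $ 0 = fps_X"
    by (simp add: fps_compose_assoc[symmetric] L0 E0 EL)
  have dE: "fps_deriv E = \<omega> oo E"
    using arg_cong[OF E, of "\<lambda>G. G $ 1"] E1
    by (simp only: subst1_2_nth_1 XY X0 fps_compose_fps_X subst1_2_X2 subst2_2_nth_1[OF Y0[OF E0] E0])
      (simp add: \<omega>_def subst1_2_Y2_nth del: One_nat_def)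
  have dP: "fps_deriv P * \<omega> = (\<omega> oo P) * fps_const (P $ 1)"
    using arg_cong[OF P, of "\<lambda>G. G $ 1"]
    by (simp only: subst1_2_nth_1 F0 X0 fps_compose_fps_X subst1_2_X2 subst2_2_nth_1[OF Y0[OF P0] P0])
      (simp add: \<omega>_def subst1_2_Y2_nth del: One_nat_def)
  have \<omega>0: "\<omega> $ 0 = 1"
    using arg_cong[OF dE, of "\<lambda>f. f $ 0"] E1 by simp
  have "fps_deriv L = inverse (\<omega> oo E oo L)"
    unfolding L_def dE[symmetric] using E0 E1 by (intro fps_inv_deriv) auto
  then have dL: "fps_deriv L = inverse \<omega>"
    by (simp add: fps_compose_assoc[symmetric] L0 E0 EL)
  have inv: "inverse \<omega> * \<omega> = 1" "inverse (\<omega> oo P) * (\<omega> oo P) = 1"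
    using \<omega>0 by (simp_all add: inverse_mult_eq_1)
  \<comment> \<open>The factor 1 = \<open>inverse \<omega> * \<omega>\<close> is inserted to form
    the product \<open>fps_deriv P * \<omega>\<close> that \<open>dP\<close> rewrites.\<close>
  have "fps_deriv (L oo P) = inverse (\<omega> oo P) * fps_deriv P * (inverse \<omega> * \<omega>)"
    using \<omega>0 P0 by (simp add: inv fps_compose_deriv dL fps_inverse_compose)
  also have "\<dots> = inverse (\<omega> oo P) * inverse \<omega> * (fps_deriv P * \<omega>)"
    by (simp only: mult_ac)
  also have "\<dots> = (inverse (\<omega> oo P) * (\<omega> oo P)) * (inverse \<omega> * fps_const (P $ 1))"
    unfolding dP by (simp only: mult_ac)
  also have "\<dots> = fps_deriv (fps_const (P $ 1) * L)"
    by (simp only: inv mult_1_left) (simp add: dL)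
  finally have LP: "L oo P = fps_const (P $ 1) * L"
    by (subst (asm) fps_deriv_eq_iff) (simp add: L0)
  have "P = E oo (L oo P)"
    by (simp add: fps_compose_assoc P0 L0 EL)
  then have "P oo E = E oo (fps_const (P $ 1) * L) oo E"
    by (simp add: LP)
  also have "\<dots> = E oo (fps_const (P $ 1) * fps_X)"
    by (simp add: fps_compose_assoc[symmetric] E0 L0 LE fps_const_mult_apply_left[symmetric])
  finally show ?thesis .
qed

section \<open>The absolute value\<close>

lemma of_nat_mem_subfield:
  assumes "is_subfield K" shows "of_nat n \<in> K"
  using assms by (induction n) (auto simp: is_subfield_def)

lemma power_mem_subfield:
  assumes "is_subfield K" and "x \<in> K" shows "x ^ n \<in> K"
  using assms by (induction n) (auto simp: is_subfield_def)

context padic_complex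
begin

text \<open>The p-adic absolute value p^(-v(x)), taken as a distance so that estimates are real
  arithmetic and connect directly to completeness.\<close>

abbreviation absv :: "'a \<Rightarrow> real" where "absv x \<equiv> dist x 0"

lemma p_gt_1: "real p > 1"
  using prime_p prime_gt_1_nat by fastforce

lemma absv_eq: "absv x = (if x = 0 then 0 else real p powr (- real_of_ereal (v x)))"
  by (simp add: dist_v)

lemma dist_eq_absv: "dist x y = absv (x - y)"
  by (simp add: dist_v)

lemma v_real:
  assumes "x \<noteq> 0" obtains a where "v x = ereal a"
  using assms v_eq_infty_iff[of x] v_not_minfty[of x] by (cases "v x") auto

lemma absv_mult: "absv (x * y) = absv x * absv y"
proof (cases "x = 0 \<or> y = 0")
  case False
  then obtain a b where "v x = ereal a" "v y = ereal b"
    using v_real by metis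
  with False show ?thesis
    using p_gt_1 by (simp add: absv_eq v_mult powr_add[symmetric])
qed auto

lemma absv_le_iff: "absv x \<le> real p powr (- a) \<longleftrightarrow> ereal a \<le> v x"
proof (cases "x = 0")
  case True
  then show ?thesis using v_eq_infty_iff[of x] by simp
next
  case False
  then obtain b where "v x = ereal b"
    by (rule v_real)
  then show ?thesis using False p_gt_1 by (simp add: absv_eq)
qed

lemma absv_less_iff: "absv x < real p powr (- a) \<longleftrightarrow> ereal a < v x"
proof (cases "x = 0")
  case True
  then show ?thesis using p_gt_1 v_eq_infty_iff[of x] by simp
next
  case False
  then obtain b where "v x = ereal b"
    by (rule v_real)
  then show ?thesis using False p_gt_1 by (simp add: absv_eq)
qed

lemma absv_le_1_iff: "absv x \<le> 1 \<longleftrightarrow> 0 \<le> v x"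
  using absv_le_iff[of x 0] p_gt_1 by (simp add: zero_ereal_def)

lemma absv_less_1_iff: "absv x < 1 \<longleftrightarrow> 0 < v x"
  using absv_less_iff[of x 0] p_gt_1 by (simp add: zero_ereal_def)

lemma absv_add: "absv (x + y) \<le> max (absv x) (absv y)"
proof (cases "x = 0 \<or> y = 0")
  case False
  then obtain a b where ab: "v x = ereal a" "v y = ereal b"
    using v_real by metis
  have "absv (x + y) \<le> real p powr (- min a b)"
    using v_add[of x y] by (simp add: absv_le_iff ab)
  then show ?thesis
    using False ab by (auto simp: absv_eq min_def max_def split: if_splits)
qed auto

lemma absv_minus: "absv (- x) = absv x"
  using dist_eq_absv[of 0 x] by (simp add: dist_commute)

lemma absv_1: "absv 1 = 1"
  using absv_mult[of 1 1] by simp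

lemma absv_power: "absv (x ^ n) = absv x ^ n"
  by (induction n) (simp_all add: absv_1 absv_mult)

lemma absv_inverse: "absv (inverse x) = inverse (absv x)"
proof (cases "x = 0")
  case False
  then have "absv x * absv (inverse x) = 1"
    by (simp add: absv_mult[symmetric] absv_1)
  then show ?thesis
    by (metis inverse_unique)
qed simp

lemma absv_p: "absv (of_nat p) = inverse (real p)"
  using v_p p_gt_1 prime_p by (auto simp: absv_eq powr_minus)

lemma absv_sum_le:
  assumes "\<And>i. i \<in> A \<Longrightarrow> absv (f i) \<le> B" and "0 \<le> B"
  shows "absv (sum f A) \<le> B"
  using assms(1)
proof (induction A rule: infinite_finite_induct)
  case (insert x A)
  then show ?case using absv_add[of "f x" "sum f A"] by fastforce
qed (use assms(2) in auto)

text \<open>Factor out \<open>x\<close>: in 1 = x^(n-1) + (1 - x^(n-1)) the first summand is smaller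
  than 1, so the ultrametric inequality forces the second to have size at least 1. This bounds the
  divisor \<pi>^n - \<pi> of the recursion from below.\<close>

lemma absv_power_diff_ge:
  assumes "absv x < 1" and "n \<ge> 2"
  shows "absv x \<le> absv (x ^ n - x)"
proof -
  have "absv (x ^ (n - 1)) < 1"
    using assms by (simp add: absv_power power_less_one_iff)
  moreover have "1 \<le> max (absv (x ^ (n - 1))) (absv (1 - x ^ (n - 1)))"
    using absv_add[of "x ^ (n - 1)" "1 - x ^ (n - 1)"] by (simp add: absv_1)
  ultimately have "1 \<le> absv (x ^ (n - 1) - 1)"
    using absv_minus[of "1 - x ^ (n - 1)"] by simp
  moreover have "x ^ n - x = x * (x ^ (n - 1) - 1)"
    using assms(2) by (cases n) (simp_all add: algebra_simps)
  ultimately show ?thesis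
    using mult_left_mono[of 1 "absv (x ^ (n - 1) - 1)" "absv x"] by (simp add: absv_mult)
qed

text \<open>By the ultrametric inequality a block of terms is no larger than the bound on its first
  term, so the partial sums are Cauchy.\<close>

lemma summable_of_geometric_bound:
  assumes "\<And>n. absv (f n) \<le> C * s ^ n" and "0 \<le> C" and "0 \<le> s" and "s < 1"
  shows "summable f"
proof -
  have tail: "dist (sum f {..<m}) (sum f {..<n}) \<le> C * s ^ m" if "m \<le> n" for m n
  proof -
    have "dist (sum f {..<m}) (sum f {..<n}) = absv (sum f {m..<n})"
      using sum_diff_nat_ivl[of 0 m n f] that
      by (subst dist_commute, subst dist_eq_absv) (simp add: atLeast0LessThan)
    also have "\<dots> \<le> C * s ^ m"
    proof (rule absv_sum_le)
      fix i assume "i \<in> {m..<n}"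
      then have "C * s ^ i \<le> C * s ^ m"
        using assms by (intro mult_left_mono power_decreasing) auto
      with assms(1)[of i] show "absv (f i) \<le> C * s ^ m"
        by simp
    qed (use assms in auto)
    finally show ?thesis .
  qed
  have "Cauchy (\<lambda>n. sum f {..<n})"
  proof (rule metric_CauchyI)
    fix e :: real assume "0 < e"
    have "(\<lambda>n. C * s ^ n) \<longlonglongrightarrow> C * 0"
      using assms by (intro tendsto_mult_left LIMSEQ_realpow_zero) auto
    then have "eventually (\<lambda>n. C * s ^ n < e) sequentially"
      using \<open>0 < e\<close> by (auto dest: order_tendstoD(2))
    then obtain M where M: "C * s ^ n < e" if "n \<ge> M" for n
      by (auto simp: eventually_sequentially)
    have "dist (sum f {..<m}) (sum f {..<n}) < e" if "m \<ge> M" "n \<ge> M" for m n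
      using tail[of m n] tail[of n m] M[OF that(1)] M[OF that(2)]
      by (cases "m \<le> n") (auto simp: dist_commute)
    then show "\<exists>M. \<forall>m\<ge>M. \<forall>n\<ge>M. dist (sum f {..<m}) (sum f {..<n}) < e"
      by blast
  qed
  then show ?thesis
    by (simp add: Cauchy_convergent_iff summable_iff_convergent)
qed

section \<open>Uniformisers and ramification\<close>

lemma absv_uniformiser:
  assumes "is_subfield K" and "uniformiser v K \<pi>"
  shows "0 < absv \<pi>" and "absv \<pi> < 1"
proof -
  have "1 \<in> val_ring v K"
    using assms(1) absv_1 absv_le_1_iff[of 1] by (auto simp: val_ring_def is_subfield_def)
  then have "\<pi> * 1 \<in> max_ideal v K"
    using assms(2) unfolding uniformiser_def by blast
  then show "absv \<pi> < 1"
    by (simp add: absv_less_1_iff max_ideal_def)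
  have "of_nat p \<in> max_ideal v K"
    using of_nat_mem_subfield[OF assms(1)] by (simp add: max_ideal_def v_p)
  then have "\<exists>y. of_nat p = \<pi> * y"
    using assms(2) unfolding uniformiser_def by blast
  then have "\<pi> \<noteq> 0"
    using prime_p by auto
  then show "0 < absv \<pi>"
    by simp
qed

text \<open>Discreteness of the valuation: no element of \<open>K\<close> has size strictly between
  |\<pi>| and 1.\<close>

lemma max_ideal_le_uniformiser:
  assumes "uniformiser v K \<pi>" and "x \<in> K" and "absv x < 1"
  shows "absv x \<le> absv \<pi>"
proof -
  have "x \<in> max_ideal v K"
    using assms(2,3) by (simp add: max_ideal_def absv_less_1_iff)
  then obtain y where "x = \<pi> * y" "y \<in> val_ring v K"
    using assms(1) unfolding uniformiser_def by blast
  then show ?thesis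
    using mult_left_mono[of "absv y" 1 "absv \<pi>"]
    by (simp add: absv_mult val_ring_def absv_le_1_iff)
qed

text \<open>Units have absolute value 1, so |x| = |\<pi>|^n, and this determines the exponent
  because 0 < |\<pi>| < 1. That is the uniqueness demanded by \<open>THE\<close>.\<close>

lemma val_pi_eqI:
  assumes "0 < absv \<pi>" and "absv \<pi> < 1"
    and "u \<in> val_ring v K" and "inverse u \<in> val_ring v K" and "u \<noteq> 0" and "x = \<pi> ^ n * u"
  shows "val_pi v K \<pi> x = int n"
proof -
  have [simp]: "absv w = 1" if "w \<in> val_ring v K" "inverse w \<in> val_ring v K" "w \<noteq> 0" for w
  proof -
    have "absv w \<le> 1" "inverse (absv w) \<le> 1"
      using that by (auto simp: val_ring_def absv_le_1_iff[symmetric] absv_inverse)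
    with that(3) show ?thesis
      by (simp add: field_simps)
  qed
  have powi: "absv (\<pi> powi k) = absv \<pi> powi k" for k
    by (cases "k \<ge> 0") (simp_all add: power_int_def absv_power absv_inverse)
  show ?thesis
    unfolding val_pi_def
  proof (rule the_equality)
    show "\<exists>u\<in>val_ring v K. inverse u \<in> val_ring v K \<and> u \<noteq> 0 \<and> x = \<pi> powi int n * u"
      using assms by auto
  next
    fix m assume "\<exists>u\<in>val_ring v K. inverse u \<in> val_ring v K \<and> u \<noteq> 0 \<and> x = \<pi> powi m * u"
    then obtain w where w: "w \<in> val_ring v K" "inverse w \<in> val_ring v K" "w \<noteq> 0"
      "x = \<pi> powi m * w" by blast
    then have "absv x = absv \<pi> powi m"
      by (simp add: absv_mult powi)
    moreover have "absv x = absv \<pi> powi int n"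
      using assms by (simp add: absv_mult absv_power)
    ultimately show "m = int n"
      using assms(1,2)
      by (metis linorder_neqE power_int_strict_decreasing order_less_irrefl)
  qed
qed

text \<open>Existence of \<open>p = \<pi>\<^sup>n u\<close> with \<open>u\<close> a unit: for the largest \<open>n\<close> with \<open>|p| \<le> |\<pi>|\<^sup>n\<close>,
  the quotient \<open>p / \<pi>\<^sup>n\<close> is too large to be a multiple of \<open>\<pi>\<close>.\<close>

lemma absv_uniformiser_eq:
  assumes K: "is_subfield K" and \<pi>: "uniformiser v K \<pi>"
  defines "e \<equiv> ramification_index p v K \<pi>"
  shows "0 < e" and "absv \<pi> = real p powr (- (1 / real_of_int e))"
proof -
  note r = absv_uniformiser[OF K \<pi>]
  have p01: "0 < absv (of_nat p)" "absv (of_nat p) < 1"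
    unfolding absv_p using p_gt_1 by (auto simp: field_simps)
  define n where "n = (LEAST n. absv \<pi> ^ Suc n < absv (of_nat p))"
  obtain k where "absv \<pi> ^ k < absv (of_nat p)"
    using real_arch_pow_inv[OF p01(1) r(2)] by blast
  then have "absv \<pi> ^ Suc k < absv (of_nat p)"
    using r by (intro le_less_trans[OF power_decreasing[of k "Suc k"]]) auto
  then have lt: "absv \<pi> ^ Suc n < absv (of_nat p)"
    unfolding n_def by (rule LeastI)
  have le: "absv (of_nat p) \<le> absv \<pi> ^ n"
  proof (cases n)
    case (Suc m)
    then have "m < n"
      by simp
    then have "\<not> absv \<pi> ^ Suc m < absv (of_nat p)"
      unfolding n_def by (rule not_less_Least)
    with Suc show ?thesis by simp
  qed (use p01 in simp)
  define u where "u = of_nat p * inverse (\<pi> ^ n)"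
  have pu: "of_nat p = \<pi> ^ n * u"
    using r by (simp add: u_def)
  have uK: "u \<in> K"
    using K of_nat_mem_subfield[OF K, of p] power_mem_subfield[OF K, of \<pi> n] \<pi>
    unfolding u_def is_subfield_def uniformiser_def val_ring_def by blast
  have absp: "absv (of_nat p) = absv \<pi> ^ n * absv u"
    by (simp add: pu absv_mult absv_power)
  have "absv u \<le> 1"
    using le r unfolding absp by simp
  moreover have "\<not> absv u < 1"
  proof
    assume "absv u < 1"
    then have "absv u \<le> absv \<pi>"
      by (rule max_ideal_le_uniformiser[OF \<pi> uK])
    then have "absv (of_nat p) \<le> absv \<pi> ^ Suc n"
      unfolding absp using r by (simp add: mult.commute)
    with lt show False by simp
  qed
  ultimately have u1: "absv u = 1"
    by simp
  have "u \<in> val_ring v K" "inverse u \<in> val_ring v K" "u \<noteq> 0"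
    using uK K u1 absv_inverse[of u]
    by (auto simp: val_ring_def is_subfield_def absv_le_1_iff[symmetric])
  then have e: "e = int n"
    unfolding e_def ramification_index_def using pu r by (intro val_pi_eqI) auto
  have pn: "absv \<pi> ^ n = inverse (real p)"
    using absp u1 absv_p by simp
  then show "0 < e"
    using e p_gt_1 by (cases n) auto
  then have "n > 0"
    using e by simp
  have "absv \<pi> = (absv \<pi> powr real n) powr (1 / real n)"
    using r \<open>n > 0\<close> by (simp add: powr_powr)
  also have "absv \<pi> powr real n = real p powr (- 1)"
    using r pn p_gt_1 by (simp add: powr_realpow powr_minus)
  finally show "absv \<pi> = real p powr (- (1 / real_of_int e))"
    by (simp only: powr_powr) (simp add: e)
qed

section \<open>The coefficients of the exponential\<close>

text \<open>The weights |f_j| t^j are submultiplicative under products. Each of the \<open>k\<close>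
  factors of \<open>E ^ k\<close> starts in degree 1, so in total degree \<open>m\<close> no factor
  can exceed degree m - k + 1 < n, where the bound on \<open>E\<close> is available.\<close>

lemma absv_power_nth_le:
  fixes E :: "'a fps"
  assumes "E $ 0 = 0" and "0 < t" and IH: "\<And>j. j < n \<Longrightarrow> absv (E $ j) * t ^ j \<le> t"
    and "0 < k" and "m < n + k - 1"
  shows "absv ((E ^ k) $ m) * t ^ m \<le> t ^ k"
  using assms(4,5)
proof (induction k arbitrary: m rule: nat_induct_non_zero)
  case 1
  then show ?case using IH by simp
next
  case (Suc k)
  have "absv ((E ^ Suc k) $ m) \<le> t ^ Suc k / t ^ m"
    unfolding power_Suc[of E] fps_mult_nth
  proof (rule absv_sum_le)
    fix i assume i: "i \<in> {0..m}"
    show "absv (E $ i * (E ^ k) $ (m - i)) \<le> t ^ Suc k / t ^ m"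
    proof (cases "i = 0 \<or> m - i < k")
      case True
      then show ?thesis
        using assms(1,2) startsby_zero_power_prefix[OF assms(1), of k] by auto
    next
      case False
      \<comment> \<open>The first bound uses that the other \<open>k\<close> factors take degree at
        least \<open>k\<close>, the second that this factor takes degree at least 1.\<close>
      then have "i < n" "m - i < n + k - 1"
        using Suc.prems i by auto
      then have "(absv (E $ i) * t ^ i) * (absv ((E ^ k) $ (m - i)) * t ^ (m - i)) \<le> t * t ^ k"
        using assms(2) by (intro mult_mono IH Suc.IH) auto
      moreover have "t ^ m = t ^ i * t ^ (m - i)"
        using i by (simp flip: power_add)
      ultimately show ?thesis
        using assms(2) by (simp add: absv_mult field_simps)
    qed
  qed (use assms(2) in simp)
  then show ?case
    using assms(2) by (simp add: field_simps)
qed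

text \<open>Comparing coefficients of \<open>X\<^sup>n\<close> in \<open>P(E(X)) = E(\<pi>X)\<close> expresses \<open>(\<pi>\<^sup>n - \<pi>) E\<^sub>n\<close> in
  terms of lower coefficients of \<open>E\<close>; the loss of \<open>|\<pi>|\<close> on the left is made up for by \<open>P\<^sub>k\<close> if
  \<open>k \<noteq> q\<close> and by \<open>t\<^sup>q\<^sup>-\<^sup>1 = |\<pi>|\<close> if \<open>k = q\<close>.\<close>

lemma absv_exp_nth_le:
  fixes E P :: "'a fps"
  assumes E: "P oo E = E oo (fps_const \<pi> * fps_X)" "E $ 0 = 0" "E $ 1 = 1"
    and \<pi>: "0 < absv \<pi>" "absv \<pi> < 1"
    and P: "P $ 0 = 0" "P $ 1 = \<pi>" "absv (P $ q) \<le> 1" "\<And>k. k \<noteq> q \<Longrightarrow> absv (P $ k) \<le> absv \<pi>"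
    and t: "0 < t" "t < 1" "t ^ (q - 1) = absv \<pi>" and q: "q \<ge> 2"
  shows "absv (E $ n) * t ^ n \<le> t"
proof (induction n rule: less_induct)
  case (less n)
  consider "n = 0" | "n = 1" | "n \<ge> 2" by linarith
  then show ?case
  proof cases
    case 1
    then show ?thesis using E t by simp
  next
    case 2
    then show ?thesis using E(3) t by (simp add: absv_1)
  next
    case 3
    define S where "S = (\<Sum>k=2..n. P $ k * (E ^ k) $ n)"
    have "{0..n} = insert 0 (insert 1 {2..n})"
      using 3 by auto
    then have "(P oo E) $ n = \<pi> * E $ n + S"
      using P by (simp add: fps_compose_nth S_def)
    moreover have "(P oo E) $ n = \<pi> ^ n * E $ n"
      unfolding E(1) by simp
    ultimately have S: "(\<pi> ^ n - \<pi>) * E $ n = S"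
      by (simp add: algebra_simps)
    have "absv S \<le> absv \<pi> * t / t ^ n"
      unfolding S_def
    proof (rule absv_sum_le)
      fix k assume k: "k \<in> {2..n}"
      \<comment> \<open>Since \<open>k \<ge> 2\<close>, degree \<open>n\<close> lies below
        \<open>n + k - 1\<close>, so the coefficients of \<open>E\<close> below \<open>n\<close>
        suffice.\<close>
      then have Ek: "absv ((E ^ k) $ n) * t ^ n \<le> t ^ k"
        using E t by (intro absv_power_nth_le less.IH) auto
      have "absv (P $ k) * t ^ k \<le> absv \<pi> * t"
      proof (cases "k = q")
        case True
        have "t ^ q = absv \<pi> * t"
          using t(3) q by (cases q) auto
        then show ?thesis
          using P(3) True mult_right_mono[of "absv (P $ q)" 1 "t ^ q"] t by simp
      next
        case False
        moreover have "t ^ k \<le> t ^ 1"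
          using k t by (intro power_decreasing) auto
        ultimately show ?thesis
          using P(4) t by (intro mult_mono) auto
      qed
      with mult_left_mono[OF Ek, of "absv (P $ k)"]
      have "absv (P $ k) * (absv ((E ^ k) $ n) * t ^ n) \<le> absv \<pi> * t"
        by simp
      then show "absv (P $ k * (E ^ k) $ n) \<le> absv \<pi> * t / t ^ n"
        using t by (simp add: absv_mult field_simps)
    qed (use \<pi> t in auto)
    moreover have "absv \<pi> * absv (E $ n) \<le> absv S"
      unfolding S[symmetric] absv_mult
      using absv_power_diff_ge[OF \<pi>(2) 3] by (intro mult_right_mono) auto
    ultimately have "absv \<pi> * absv (E $ n) \<le> absv \<pi> * (t / t ^ n)"
      by simp
    then show ?thesis
      using \<pi>(1) t by (simp add: field_simps)
  qed
qed

lemma lubin_tate_seriesD: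
  assumes "lubin_tate_series v K \<pi> P" and "absv \<pi> < 1"
  defines "q \<equiv> residue_card v K"
  shows "P $ 0 = 0" and "P $ 1 = \<pi>" and "absv (P $ k) \<le> 1" and "q \<ge> 2"
    and "k \<noteq> q \<Longrightarrow> absv (P $ k) \<le> absv \<pi>"
proof -
  obtain Q R where Q: "P - fps_const \<pi> * fps_X = fps_X ^ 2 * Q"
    and R: "R \<in> fps_over (val_ring v K)" "P - fps_X ^ q = fps_const \<pi> * R"
    and P: "P \<in> fps_over (val_ring v K)"
    using assms(1) unfolding lubin_tate_series_def q_def by blast
  show P0: "P $ 0 = 0"
    using arg_cong[OF Q, of "\<lambda>f. f $ 0"] by simp
  show P1: "P $ 1 = \<pi>"
    using arg_cong[OF Q, of "\<lambda>f. f $ 1"] by (simp add: fps_X_power_mult_nth)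
  show "absv (P $ k) \<le> 1"
    using P by (simp add: fps_over_def val_ring_def absv_le_1_iff)
  have Rk: "P $ k - (if k = q then 1 else 0) = \<pi> * R $ k" "absv (\<pi> * R $ k) \<le> absv \<pi>" for k
  proof -
    show "P $ k - (if k = q then 1 else 0) = \<pi> * R $ k"
      using arg_cong[OF R(2), of "\<lambda>f. f $ k"] by simp
    have "absv (R $ k) \<le> 1"
      using R(1) by (simp add: fps_over_def val_ring_def absv_le_1_iff)
    then show "absv (\<pi> * R $ k) \<le> absv \<pi>"
      using mult_left_mono[of "absv (R $ k)" 1 "absv \<pi>"] by (simp add: absv_mult)
  qed
  show "absv (P $ k) \<le> absv \<pi>" if "k \<noteq> q"
    using Rk[of k] that by simp
  \<comment> \<open>If \<open>q\<close> were 0 or 1 (0 being also the value of \<open>card\<close>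
    on an infinite set), the coefficient of \<open>P\<close> at \<open>q\<close> would be 0 or
    \<open>\<pi>\<close>, yet it is congruent to 1 modulo \<open>\<pi>\<close>.\<close>
  show "q \<ge> 2"
  proof (rule ccontr)
    assume "\<not> q \<ge> 2"
    then have "absv (P $ q) < 1"
      using P0 P1 assms(2) by (cases "q = 0") (auto simp: less_2_cases_iff not_le)
    moreover have "absv (P $ q - 1) < 1"
      using Rk[of q] assms(2) by simp
    ultimately show False
      using absv_add[of "P $ q" "- (P $ q - 1)"] absv_minus[of "P $ q - 1"] by (simp add: absv_1)
  qed
qed

end

theorem proposition2p7:
  fixes p :: nat
    and v :: "'a::{field_char_0, complete_space} \<Rightarrow> ereal"
    and K :: "'a set" and \<pi> :: 'a
    and P E :: "'a fps" and F :: "'a fps fps"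
  assumes "padic_complex p v"
    and "finite_extension_Qp K"
    and "uniformiser v K \<pi>"
    and "lubin_tate_series v K \<pi> P"
    and "lubin_tate_formal_group v K P F"
    and "formal_group_exp K F E"
  shows "\<forall>x \<in> {x. v x > ereal (1 / (real_of_int (ramification_index p v K \<pi>) *
                                    (real (residue_card v K) - 1)))}.
           summable (\<lambda>n. fps_nth E n * x ^ n)"
proof (intro ballI)
  interpret padic_complex p v by fact
  define e where "e = ramification_index p v K \<pi>"
  define q where "q = residue_card v K"
  \<comment> \<open>The radius of the disc, chosen so that
    \<open>t ^ (q - 1) = absv \<pi>\<close>.\<close>
  define t where "t = real p powr (- (1 / (real_of_int e * (real q - 1))))"
  fix x assume "x \<in> {x. v x > ereal (1 / (real_of_int (ramification_index p v K \<pi>) *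
                                    (real (residue_card v K) - 1)))}"
  then have x: "absv x < t"
    by (simp add: t_def e_def q_def absv_less_iff)
  have K: "is_subfield K"
    using assms(2) by (simp add: finite_extension_Qp_def)
  note \<pi> = absv_uniformiser[OF K assms(3)]
  note P = lubin_tate_seriesD[OF assms(4) \<pi>(2), folded q_def]
  have e: "0 < e" "absv \<pi> = real p powr (- (1 / real_of_int e))"
    unfolding e_def using absv_uniformiser_eq[OF K assms(3)] by auto
  have t: "0 < t" "t < 1"
    using p_gt_1 e(1) P(4) by (auto simp: t_def powr_less_one)
  have "t ^ (q - 1) = t powr (real q - 1)"
    using t(1) P(4) by (simp add: powr_realpow[symmetric] of_nat_diff)
  then have tq: "t ^ (q - 1) = absv \<pi>"
    using e(1) P(4) by (simp add: t_def powr_powr e(2))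
  obtain Q where Q: "E - fps_X = fps_X ^ 2 * Q"
    and E0: "E $ 0 = 0"
    and E: "subst1_2 E (X2 + Y2) = subst2_2 F (subst1_2 E X2) (subst1_2 E Y2)"
    using assms(6) unfolding formal_group_exp_def by blast
  have E1: "E $ 1 = 1"
    using arg_cong[OF Q, of "\<lambda>f. f $ 1"] by (simp add: fps_X_power_mult_nth)
  have "P oo E = E oo (fps_const \<pi> * fps_X)"
    using compose_exp_eq_exp_scaled[OF E0 E1 P(1) E] assms(5) P(2)
    by (simp add: lubin_tate_formal_group_def)
  then have En: "absv (E $ n) * t ^ n \<le> t" for n
    using P \<pi> E0 E1 t tq by (intro absv_exp_nth_le[where P = P and q = q]) auto
  show "summable (\<lambda>n. E $ n * x ^ n)"
  \<comment> \<open>The constant is \<open>t\<close> and the ratio \<open>absv x / t\<close>, which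
    is below 1 exactly because \<open>x\<close> lies in the open disc.\<close>
  proof (rule summable_of_geometric_bound)
    fix n
    have "absv (E $ n * x ^ n) = (absv (E $ n) * t ^ n) * (absv x / t) ^ n"
      using t by (simp add: absv_mult absv_power power_divide)
    also have "\<dots> \<le> t * (absv x / t) ^ n"
      using En t by (intro mult_right_mono) auto
    finally show "absv (E $ n * x ^ n) \<le> t * (absv x / t) ^ n" .
  qed (use x t in auto)
qed

end
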